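(* Let $\Gamma$ be a thick partial geometry $\mathsf{pg}(s,t,\alpha)$, and consider the association scheme of its collinearity graph with minimal idempotents $E_0,E_1,E_2$ ordered as described in the context. Then for $i\in\{1,2\}$, the Krein parameter $q_{ii}^i$ is zero if and only if $i=2$, \[ \alpha=\frac{s^2-t-1+\sqrt{t(t+1-s^2)}}{s-1}, \] and $t\ge s^2$. Moreover, in this case, $\alpha=1$ if and only if $t=s^2$.
   Context: A partial geometry $\mathsf{pg}(s,t,\alpha)$ is a point–line incidence structure in which any two distinct points lie on at most one common line, every line contains $s+1$ points, every point lies on $t+1$ lines, and for every point $P$ and line $\ell$ not incident with $P$ there are exactly $\alpha$ points on $\ell$ collinear with $P$. It is thick if $s,t>1$. Its collinearity graph (vertices the points, adjacency being distinct and collinear) is strongly regular with $(s+1)(st+\alpha)/\alpha$ vertices, and it gives a 2-class association scheme. Its minimal idempotents are ordered $E_0=\frac1{|\Omega|}J$, $E_1$, $E_2$ so that the matrix of eigenvalues ($P_{i\ell}$ = eigenvalue of the $\ell$-th adjacency matrix $A_\ell$ on the column space of $E_i$, with $A_1$ the collinearity adjacency matrix and $A_2$ the non-collinearity one) is \[ P=\begin{bmatrix}1&s(t+1)&\tfrac{st}{\alpha}(s+1-\alpha)\\ 1&s-\alpha&\alpha-s-1\\ 1&-t-1&t\end{bmatrix}. \] Krein parameters are defined by $E_i\circ E_j=\frac{1}{|\Omega|}\sum_h q_{ij}^hE_h$ ($\circ$ the entrywise product); equivalently $q_{ij}^h=\frac{m_im_j}{|\Omega|}\sum_{\ell}\frac{P_{i\ell}P_{j\ell}P_{h\ell}}{k_\ell^2}$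 with $k_\ell=P_{0\ell}$ and $m_i$ the rank of $E_i$. *)

theory Defs
  imports "HOL-Analysis.Analysis"
begin

text \<open>
  The points and the lines of an incidence structure are the elements of two types;
  \<open>inc x l\<close> states that the point \<open>x\<close> is incident with the line \<open>l\<close>.
\<close>

definition collinear_points :: "('p \<Rightarrow> 'l \<Rightarrow> bool) \<Rightarrow> 'p \<Rightarrow> 'p \<Rightarrow> bool" where
  "collinear_points inc x y \<longleftrightarrow> (\<exists>l. inc x l \<and> inc y l)"

definition partial_geometry ::
    "('p \<Rightarrow> 'l \<Rightarrow> bool) \<Rightarrow> nat \<Rightarrow> nat \<Rightarrow> nat \<Rightarrow> bool" where
  "partial_geometry inc s t \<alpha> \<longleftrightarrow>
     (\<forall>x y l m. x \<noteq> y \<and> inc x l \<and> inc y l \<and> inc x m \<and> inc y m \<longrightarrow> l = m) \<and>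
     (\<forall>l. card {x. inc x l} = s + 1) \<and>
     (\<forall>x. card {l. inc x l} = t + 1) \<and>
     (\<forall>x l. \<not> inc x l \<longrightarrow> card {y. inc y l \<and> collinear_points inc x y} = \<alpha>)"

definition thick_partial_geometry ::
    "('p \<Rightarrow> 'l \<Rightarrow> bool) \<Rightarrow> nat \<Rightarrow> nat \<Rightarrow> nat \<Rightarrow> bool" where
  "thick_partial_geometry inc s t \<alpha> \<longleftrightarrow> partial_geometry inc s t \<alpha> \<and> s > 1 \<and> t > 1"

definition adjacency_matrix ::
    "('p \<Rightarrow> 'l \<Rightarrow> bool) \<Rightarrow> nat \<Rightarrow> real ^ 'p ^ 'p::finite" where
  "adjacency_matrix inc k = (\<chi> x y. of_bool
     (k = 0 \<and> x = y \<or>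
      k = 1 \<and> x \<noteq> y \<and> collinear_points inc x y \<or>
      k = 2 \<and> x \<noteq> y \<and> \<not> collinear_points inc x y))"

definition bose_mesner_algebra ::
    "nat \<Rightarrow> (nat \<Rightarrow> real ^ 'n ^ 'n) \<Rightarrow> (real ^ 'n ^ 'n::finite) set" where
  "bose_mesner_algebra d A = span (A ` {..d})"

text \<open>
  Minimality refers to the usual order of idempotents, in which \<open>F\<close> is below \<open>E\<close>
  if \<open>E F = F E = F\<close>.
\<close>

definition minimal_idempotent ::
    "(real ^ 'n ^ 'n) set \<Rightarrow> real ^ 'n ^ 'n::finite \<Rightarrow> bool" where
  "minimal_idempotent \<A> E \<longleftrightarrow>
     E \<in> \<A> \<and> E \<noteq> 0 \<and> E ** E = E \<and>
     (\<forall>F\<in>\<A>. F ** F = F \<and> E ** F = F \<and> F ** E = F \<longrightarrow> F = 0 \<or> F = E)"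

definition matrix_of_eigenvalues ::
    "nat \<Rightarrow> (nat \<Rightarrow> real ^ 'n ^ 'n) \<Rightarrow> (nat \<Rightarrow> real ^ 'n ^ 'n::finite) \<Rightarrow>
     (nat \<Rightarrow> nat \<Rightarrow> real) \<Rightarrow> bool" where
  "matrix_of_eigenvalues d A E P \<longleftrightarrow>
     (\<forall>i\<le>d. \<forall>k\<le>d. \<forall>v\<in>span (columns (E i)). A k *v v = P i k *\<^sub>R v)"

definition pg_eigenvalues :: "nat \<Rightarrow> nat \<Rightarrow> nat \<Rightarrow> nat \<Rightarrow> nat \<Rightarrow> real" where
  "pg_eigenvalues s t \<alpha> i k =
     [[1, real s * (real t + 1), real s * real t / real \<alpha> * (real s + 1 - real \<alpha>)],
      [1, real s - real \<alpha>, real \<alpha> - real s - 1],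
      [1, - real t - 1, real t]] ! i ! k"

text \<open>
  On the type \<open>real ^ 'n ^ 'n\<close> the operation \<open>*\<close> is the entrywise product, whereas \<open>**\<close>
  is the matrix product.  The coefficients of the expansion below are unique for indices
  up to \<open>d\<close> because distinct minimal idempotents are linearly independent.
\<close>

definition krein_parameter ::
    "nat \<Rightarrow> (nat \<Rightarrow> real ^ 'n ^ 'n::finite) \<Rightarrow> nat \<Rightarrow> nat \<Rightarrow> nat \<Rightarrow> real" where
  "krein_parameter d E i j h =
     (SOME q. E i * E j = (1 / real CARD('n)) *\<^sub>R (\<Sum>k\<le>d. q k *\<^sub>R E k)) h"

end

theory Submission
  imports Defs
begin

text \<open>
  Since \<open>A\<^sub>k E\<^sub>i = P\<^sub>i\<^sub>k E\<^sub>i\<close>, comparing diagonal entries shows that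
  \<open>E\<^sub>i = a \<Sum>\<^sub>k (P\<^sub>i\<^sub>k / P\<^sub>0\<^sub>k) A\<^sub>k\<close> with \<open>a \<noteq> 0\<close>.  Multiplying the expansion of the entrywise
  square of \<open>E\<^sub>i\<close> by \<open>E\<^sub>i\<close> and comparing diagonal entries again, \<open>q\<^sub>i\<^sub>i\<^sup>i\<close> is a nonzero multiple of
  \<open>\<Sum>\<^sub>k P\<^sub>i\<^sub>k\<^sup>3 / P\<^sub>0\<^sub>k\<^sup>2\<close>.  For \<open>i = 1\<close> this sum is positive because \<open>\<alpha> \<le> s\<close> and \<open>\<alpha> \<le> t + 1\<close>;
  for \<open>i = 2\<close> it vanishes iff \<open>(t + 1 - s\<^sup>2) (s + 1 - \<alpha>)\<^sup>2 = t \<alpha>\<^sup>2\<close>, a quadratic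
  equation whose only root with \<open>0 < \<alpha> \<le> s\<close> is the one in the theorem.
\<close>

section \<open>Eigenvalues of symmetric schemes\<close>

lemma matrix_of_eigenvalues_mult:
  assumes "matrix_of_eigenvalues d A E P" "i \<le> d" "k \<le> d"
  shows "A k ** E i = P i k *\<^sub>R E i"
proof -
  have "(A k ** E i) $ x $ y = (P i k *\<^sub>R E i) $ x $ y" for x y
  proof -
    have "column y (E i) \<in> span (columns (E i))"
      by (intro span_base) (auto simp: columns_def)
    then have "A k *v column y (E i) = P i k *\<^sub>R column y (E i)"
      using assms by (auto simp: matrix_of_eigenvalues_def)
    then have "(A k *v column y (E i)) $ x = (P i k *\<^sub>R column y (E i)) $ x"
      by simp
    then show ?thesis
      by (simp add: matrix_matrix_mult_def matrix_vector_mult_def column_def)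
  qed
  then show ?thesis by (simp add: vec_eq_iff)
qed

text \<open>The columns of \<open>E 0\<close> are constant vectors, and a matrix acts on these
  through its row sums. Valencies are thus read off row 0 of \<open>P\<close> instead of being
  counted.\<close>

lemma row_sum_eq_eigenvalue:
  fixes A E :: "nat \<Rightarrow> real ^ 'n ^ 'n::finite"
  assumes "matrix_of_eigenvalues d A E P" "k \<le> d" "E 0 = (\<chi> x y. 1 / real CARD('n))"
  shows "(\<Sum>y\<in>UNIV. A k $ x $ y) = P 0 k"
proof -
  have "(A k ** E 0) $ x $ x = (P 0 k *\<^sub>R E 0) $ x $ x"
    using matrix_of_eigenvalues_mult[OF assms(1) _ assms(2), of 0] by simp
  then show ?thesis
    by (simp add: assms(3) matrix_matrix_mult_def flip: sum_divide_distrib)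
qed

text \<open>The relations are encoded as one colouring \<open>c\<close>, so that members of the
  Bose-Mesner algebra become functions of the colour. Regularity enters through the eigenvalue
  equations instead of intersection numbers; \<open>separated\<close> will make distinct idempotents
  orthogonal.\<close>

locale symmetric_scheme =
  fixes c :: "'n::finite \<Rightarrow> 'n \<Rightarrow> nat" and d :: nat
    and A E :: "nat \<Rightarrow> real ^ 'n ^ 'n" and P :: "nat \<Rightarrow> nat \<Rightarrow> real"
  assumes A_eq: "A k = (\<chi> x y. of_bool (c x y = k))"
    and c_sym: "c x y = c y x"
    and c_le: "c x y \<le> d"
    and c_eq_0: "c x y = 0 \<longleftrightarrow> x = y"
    and E_mem: "i \<le> d \<Longrightarrow> E i \<in> bose_mesner_algebra d A"
    and E_idem: "i \<le> d \<Longrightarrow> E i ** E i = E i"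
    and E_nz: "i \<le> d \<Longrightarrow> E i \<noteq> 0"
    and E_0: "E 0 = (\<chi> x y. 1 / real CARD('n))"
    and eigenvalues: "matrix_of_eigenvalues d A E P"
    and valency_nz: "k \<le> d \<Longrightarrow> P 0 k \<noteq> 0"
    and separated: "i \<le> d \<Longrightarrow> j \<le> d \<Longrightarrow> i \<noteq> j \<Longrightarrow> \<exists>k\<le>d. P i k \<noteq> P j k"
begin

section \<open>Matrices as functions of the relation\<close>

lemma c_diag: "c x x = 0"
  by (simp add: c_eq_0)

lemma sum_entries_nth: "(\<Sum>k\<le>d. f k *\<^sub>R A k) $ x $ y = f (c x y)"
  using c_le[of x y] by (simp add: A_eq if_distrib cong: if_cong)

lemma bose_mesner_entries:
  assumes "M \<in> bose_mesner_algebra d A"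
  obtains f where "\<And>x y. M $ x $ y = f (c x y)"
proof -
  have "\<exists>f. \<forall>x y. M $ x $ y = f (c x y)"
    using assms unfolding bose_mesner_algebra_def
  proof (induction rule: span_induct_alt)
    case base
    show ?case by (rule exI[of _ "\<lambda>_. 0"]) simp
  next
    case (step r B M)
    then obtain k f where "B = A k" "\<forall>x y. M $ x $ y = f (c x y)" by auto
    then have "\<forall>x y. (r *\<^sub>R B + M) $ x $ y = (\<lambda>l. r * of_bool (l = k) + f l) (c x y)"
      by (simp add: A_eq)
    then show ?case by (rule exI[of _ "\<lambda>l. r * of_bool (l = k) + f l"])
  qed
  then show thesis using that by blast
qed

lemma entries_bose_mesner:
  assumes "\<And>x y. M $ x $ y = f (c x y)"
  shows "M \<in> bose_mesner_algebra d A"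
proof -
  have "M = (\<Sum>k\<le>d. f k *\<^sub>R A k)"
    by (simp add: vec_eq_iff assms sum_entries_nth del: sum_component)
  also have "\<dots> \<in> bose_mesner_algebra d A"
    unfolding bose_mesner_algebra_def
    by (intro span_sum span_scale span_base) auto
  finally show ?thesis .
qed

text \<open>Grouping the \<open>y\<close> by colour, class \<open>k\<close> contributes
  \<open>P 0 k\<close> equal terms, since the row sums of \<open>A k\<close> are the
  valencies.\<close>

lemma sum_by_relation:
  "(\<Sum>y\<in>UNIV. f (c x y)) = (\<Sum>k\<le>d. P 0 k * f k)"
proof -
  have "(\<Sum>y\<in>UNIV. f (c x y)) = (\<Sum>y\<in>UNIV. \<Sum>k\<le>d. A k $ x $ y * f k)"
    using c_le by (simp add: A_eq)
  also have "\<dots> = (\<Sum>k\<le>d. (\<Sum>y\<in>UNIV. A k $ x $ y) * f k)"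
    by (subst sum.swap) (simp add: sum_distrib_right)
  also have "\<dots> = (\<Sum>k\<le>d. P 0 k * f k)"
    using row_sum_eq_eigenvalue[OF eigenvalues _ E_0] by simp
  finally show ?thesis .
qed

lemma idempotent_entries:
  assumes i: "i \<le> d"
  obtains a where "a \<noteq> 0" "\<And>x. E i $ x $ x = a"
    "\<And>x y. E i $ x $ y = a * P i (c x y) / P 0 (c x y)"
proof -
  obtain f where f: "\<And>x y. E i $ x $ y = f (c x y)"
    using bose_mesner_entries[OF E_mem[OF i]] by blast
  have fk: "f k = f 0 * P i k / P 0 k" if k: "k \<le> d" for k
  proof -
    fix x
    \<comment> \<open>A diagonal entry of \<open>A k ** E i\<close> only sees the pairs of colour
      \<open>k\<close>, on which \<open>E i\<close> is constant; this ties \<open>f k\<close> to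
      \<open>f 0\<close>.\<close>
    have "(\<Sum>y\<in>UNIV. of_bool (c x y = k) * f (c x y)) = P i k * f 0"
      using arg_cong[OF matrix_of_eigenvalues_mult[OF eigenvalues i k], of "\<lambda>M. M $ x $ x"]
      by (simp add: matrix_matrix_mult_def f A_eq c_diag c_sym[of _ x])
    moreover have "(\<Sum>y\<in>UNIV. of_bool (c x y = k) * f (c x y)) = P 0 k * f k"
      using k by (simp add: sum_by_relation[of "\<lambda>l. of_bool (l = k) * f l"]
          mult.left_commute[of "P 0 _"])
    ultimately show ?thesis using valency_nz[OF k] by (simp add: field_simps)
  qed
  have entries: "E i $ x $ y = f 0 * P i (c x y) / P 0 (c x y)" for x y
    using f fk c_le by metis
  then have "f 0 \<noteq> 0"
    using E_nz[OF i] by (auto simp: vec_eq_iff)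
  then show thesis using entries that f c_diag by metis
qed

section \<open>Orthogonal idempotents as a basis of the algebra\<close>

lemma E_transpose:
  assumes "i \<le> d"
  shows "transpose (E i) = E i"
proof -
  obtain f where "\<And>x y. E i $ x $ y = f (c x y)"
    using bose_mesner_entries[OF E_mem[OF assms]] by blast
  then show ?thesis by (simp add: transpose_def vec_eq_iff c_sym)
qed

lemma A_transpose: "transpose (A k) = A k"
  using c_sym by (simp add: A_eq transpose_def vec_eq_iff)

text \<open>The product of \<open>E i\<close>, \<open>A k\<close> and \<open>E j\<close> is
  evaluated in two ways: by symmetry \<open>A k\<close> acts on \<open>E i\<close> from the right as
  \<open>P i k\<close>, and it acts on \<open>E j\<close> from the left as
  \<open>P j k\<close>.\<close>

lemma orthogonal_idempotents:
  assumes i: "i \<le> d" and j: "j \<le> d" and "i \<noteq> j"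
  shows "E i ** E j = 0"
proof -
  obtain k where k: "k \<le> d" "P i k \<noteq> P j k"
    using separated assms by blast
  have "E i ** A k = transpose (A k ** E i)"
    by (simp add: matrix_transpose_mul E_transpose[OF i] A_transpose)
  also have "\<dots> = P i k *\<^sub>R E i"
    using matrix_of_eigenvalues_mult[OF eigenvalues i k(1)] E_transpose[OF i]
    by (simp add: transpose_scalar)
  finally have "P i k *\<^sub>R (E i ** E j) = E i ** (A k ** E j)"
    by (simp add: matrix_mul_assoc scalar_matrix_assoc)
  also have "\<dots> = P j k *\<^sub>R (E i ** E j)"
    using matrix_of_eigenvalues_mult[OF eigenvalues j k(1)]
    by (simp add: matrix_scalar_ac flip: scalar_matrix_assoc)
  finally show ?thesis using k(2) by simp
qed

lemma expansion_mult:
  assumes "i \<le> d"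
  shows "(\<Sum>k\<le>d. q k *\<^sub>R E k) ** E i = q i *\<^sub>R E i"
proof -
  have "(\<Sum>k\<le>d. q k *\<^sub>R E k) ** E i = (\<Sum>k\<le>d. q k *\<^sub>R (E k ** E i))"
    by (simp add: vec_eq_iff matrix_matrix_mult_def sum_distrib_right sum_distrib_left mult.assoc)
       (intro allI sum.swap)
  also have "\<dots> = (\<Sum>k\<le>d. if k = i then q i *\<^sub>R E i else 0)"
    using assms by (intro sum.cong) (auto simp: orthogonal_idempotents E_idem)
  finally show ?thesis using assms by simp
qed

text \<open>If \<open>E i = E j\<close> with distinct indices, then
  \<open>E i = E i ** E j = 0\<close>.\<close>

lemma E_inj: "inj_on E {..d}"
  using orthogonal_idempotents E_idem E_nz by (intro inj_onI) (metis atMost_iff)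

lemma E_independent: "independent (E ` {..d})"
proof
  assume "dependent (E ` {..d})"
  then obtain u v where u: "(\<Sum>v\<in>E ` {..d}. u v *\<^sub>R v) = 0" and "v \<in> E ` {..d}" "u v \<noteq> 0"
    by (auto simp: dependent_finite)
  then obtain i where i: "i \<le> d" "u (E i) \<noteq> 0" by auto
  have "(\<Sum>k\<le>d. u (E k) *\<^sub>R E k) = 0"
    using u by (simp add: sum.reindex[OF E_inj])
  then have "u (E i) *\<^sub>R E i = 0"
    using expansion_mult[OF i(1), of "\<lambda>k. u (E k)"] by simp
  then show False using i E_nz by simp
qed

text \<open>Dimension count: the algebra is spanned by at most \<open>d + 1\<close> matrices and
  contains \<open>d + 1\<close> independent idempotents, which therefore span it.\<close>

lemma bose_mesner_expansion:
  assumes "M \<in> bose_mesner_algebra d A"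
  obtains q where "M = (\<Sum>k\<le>d. q k *\<^sub>R E k)"
proof -
  have "dim (bose_mesner_algebra d A) \<le> card (A ` {..d})"
    unfolding bose_mesner_algebra_def by (simp add: dim_le_card')
  also have "\<dots> \<le> card (E ` {..d})"
    using card_image_le[of "{..d}" A] by (simp add: card_image[OF E_inj])
  finally have "bose_mesner_algebra d A \<subseteq> span (E ` {..d})"
    using E_mem E_independent by (intro card_ge_dim_independent) auto
  then obtain u where "M = (\<Sum>v\<in>E ` {..d}. u v *\<^sub>R v)"
    using assms by (auto simp: span_finite)
  then have "M = (\<Sum>k\<le>d. u (E k) *\<^sub>R E k)"
    by (simp add: sum.reindex[OF E_inj])
  then show thesis by (rule that)
qed

text \<open>In any valid expansion, multiplication by \<open>E i\<close> determines the coefficient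
  \<open>q i\<close>; so the choice made by \<open>SOME\<close> is harmless once some expansion is
  known to exist.\<close>

lemma krein_parameter_eq_0_iff:
  assumes i: "i \<le> d"
  shows "krein_parameter d E i i i = 0 \<longleftrightarrow> (\<Sum>k\<le>d. P i k ^ 3 / (P 0 k)\<^sup>2) = 0"
proof -
  let ?n = "real CARD('n)"
  fix x :: 'n
  define q where "q = (SOME q. E i * E i = (1 / ?n) *\<^sub>R (\<Sum>k\<le>d. q k *\<^sub>R E k))"
  obtain a where a: "a \<noteq> 0" "\<And>x. E i $ x $ x = a"
    and entries: "\<And>x y. E i $ x $ y = a * P i (c x y) / P 0 (c x y)"
    using idempotent_entries[OF i] by blast
  have "E i * E i \<in> bose_mesner_algebra d A"
    by (rule entries_bose_mesner[where f = "\<lambda>k. (a * P i k / P 0 k)\<^sup>2"])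
       (simp add: entries power2_eq_square)
  then obtain p where "E i * E i = (\<Sum>k\<le>d. p k *\<^sub>R E k)"
    by (rule bose_mesner_expansion)
  \<comment> \<open>Scaling the coefficients by \<open>?n\<close> cancels the normalising factor and
    gives the witness that \<open>SOME\<close> needs.\<close>
  then have "E i * E i = (1 / ?n) *\<^sub>R (\<Sum>k\<le>d. (?n * p k) *\<^sub>R E k)"
    by (simp add: scaleR_sum_right)
  then have "E i * E i = (1 / ?n) *\<^sub>R (\<Sum>k\<le>d. q k *\<^sub>R E k)"
    unfolding q_def
    by (rule someI[where P = "\<lambda>q. E i * E i = (1 / ?n) *\<^sub>R (\<Sum>k\<le>d. q k *\<^sub>R E k)"])
  then have "(E i * E i) ** E i = (1 / ?n * q i) *\<^sub>R E i"
    using expansion_mult[OF i, of q] by (simp flip: scalar_matrix_assoc)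
  \<comment> \<open>Since \<open>E i\<close> is symmetric, this diagonal entry is the sum of the
    cubes of the entries in row \<open>x\<close>.\<close>
  moreover have "((E i * E i) ** E i) $ x $ x
      = (\<Sum>y\<in>UNIV. (\<lambda>k. (a * P i k / P 0 k) ^ 3) (c x y))"
    by (simp add: matrix_matrix_mult_def entries c_sym[of _ x] power3_eq_cube)
  moreover have "\<dots> = (\<Sum>k\<le>d. P 0 k * (a * P i k / P 0 k) ^ 3)"
    by (rule sum_by_relation)
  moreover have "\<dots> = a ^ 3 * (\<Sum>k\<le>d. P i k ^ 3 / (P 0 k)\<^sup>2)"
    unfolding sum_distrib_left using valency_nz
    by (intro sum.cong) (auto simp: field_simps power2_eq_square power3_eq_cube)
  ultimately have "a ^ 3 * (\<Sum>k\<le>d. P i k ^ 3 / (P 0 k)\<^sup>2) = 1 / ?n * q i * E i $ x $ x"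
    by simp
  then show ?thesis
    using a by (auto simp: krein_parameter_def q_def[symmetric])
qed

end

section \<open>Partial geometries\<close>

lemma ex_other:
  assumes "card S > 1"
  shows "\<exists>a\<in>S. a \<noteq> b"
proof (rule ccontr)
  assume "\<not> ?thesis"
  then have "card S \<le> card {b}" by (intro card_mono) auto
  with assms show False by simp
qed

text \<open>For a point \<open>x\<close> off a line \<open>l\<close>, the \<alpha> points of
  \<open>l\<close> collinear with \<open>x\<close> are joined to \<open>x\<close> by distinct lines,
  and only \<open>t + 1\<close> lines pass through \<open>x\<close>. Positivity of \<open>s\<close>
  and \<open>t\<close> supplies such a pair.\<close>

lemma partial_geometry_alpha_le:
  fixes inc :: "'p \<Rightarrow> 'l \<Rightarrow> bool"
  assumes pg: "partial_geometry inc s t \<alpha>" and "s > 0" "t > 0"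
  shows "\<alpha> \<le> t + 1"
proof -
  have unique: "l = m" if "x \<noteq> y" "inc x l" "inc y l" "inc x m" "inc y m" for x y l m
    using pg that unfolding partial_geometry_def by blast
  have lines: "card {l. inc x l} = t + 1" and pts: "card {x. inc x l} = s + 1" for x l
    using pg unfolding partial_geometry_def by blast+
  fix x\<^sub>0 :: 'p
  obtain l where l: "inc x\<^sub>0 l"
    using ex_other[of "{l. inc x\<^sub>0 l}"] lines \<open>t > 0\<close> by auto
  obtain m where m: "inc x\<^sub>0 m" "m \<noteq> l"
    using ex_other[of "{l. inc x\<^sub>0 l}" l] lines \<open>t > 0\<close> by auto
  obtain x where x: "inc x m" "x \<noteq> x\<^sub>0"
    using ex_other[of "{x. inc x m}" x\<^sub>0] pts \<open>s > 0\<close> by auto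
  have nl: "\<not> inc x l" using unique[of x x\<^sub>0 l m] l m x by blast
  let ?Y = "{y. inc y l \<and> collinear_points inc x y}"
  define join where "join y = (SOME k. inc x k \<and> inc y k)" for y
  have join: "inc x (join y) \<and> inc y (join y)" if "y \<in> ?Y" for y
    using that unfolding join_def collinear_points_def by - (rule someI_ex, blast)
  have "inj_on join ?Y"
  proof (rule inj_onI, rule ccontr)
    fix y z assume yz: "y \<in> ?Y" "z \<in> ?Y" "join y = join z" "y \<noteq> z"
    then have "join y = l" using unique[of y z "join y" l] join[of y] join[of z] by simp
    then show False using join[of y] yz nl by simp
  qed
  moreover have "join ` ?Y \<subseteq> {k. inc x k}" using join by blast
  \<comment> \<open>The type of lines carries no finiteness constraint, but \<open>card\<close> is 0
    on infinite sets.\<close>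
  moreover have "finite {k. inc x k}" using lines[of x] by (intro card_ge_0_finite) simp
  ultimately have "card ?Y \<le> card {k. inc x k}" by (intro card_inj_on_le)
  moreover have "card ?Y = \<alpha>" using pg nl unfolding partial_geometry_def by blast
  ultimately show ?thesis using lines by simp
qed

section \<open>Krein sums and the quadratic equation for \<alpha>\<close>

lemma pg_eigenvalues_simps [simp]:
  "pg_eigenvalues s t \<alpha> 0 0 = 1"
  "pg_eigenvalues s t \<alpha> 1 0 = 1"
  "pg_eigenvalues s t \<alpha> 2 0 = 1"
  "pg_eigenvalues s t \<alpha> 0 1 = real s * (real t + 1)"
  "pg_eigenvalues s t \<alpha> 0 2 = real s * real t / real \<alpha> * (real s + 1 - real \<alpha>)"
  "pg_eigenvalues s t \<alpha> 1 1 = real s - real \<alpha>"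
  "pg_eigenvalues s t \<alpha> 1 2 = real \<alpha> - real s - 1"
  "pg_eigenvalues s t \<alpha> 2 1 = - real t - 1"
  "pg_eigenvalues s t \<alpha> 2 2 = real t"
  by (simp_all add: pg_eigenvalues_def)

text \<open>The simplifier turns the index 1 into \<open>Suc 0\<close>, so the rules are also
  supplied in that form.\<close>

declare pg_eigenvalues_simps [unfolded One_nat_def, simp]

text \<open>Only the third summand can be negative; cancelling \<open>s + 1 - \<alpha>\<close>
  leaves a quotient by \<open>(s * t)\<^sup>2\<close>, whose absolute value is shown to be below
  1.\<close>

lemma krein_sum_1_pos:
  fixes s t \<alpha> :: real
  assumes "s \<ge> 2" "t \<ge> 2" "\<alpha> \<ge> 1" "\<alpha> \<le> s" "\<alpha> \<le> t + 1"
  shows "1 + (s - \<alpha>) ^ 3 / (s * (t + 1))\<^sup>2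
           + (\<alpha> - s - 1) ^ 3 / (s * t / \<alpha> * (s + 1 - \<alpha>))\<^sup>2 > 0"
proof -
  have "(\<alpha> - s - 1) ^ 3 = - ((s + 1 - \<alpha>) * (s + 1 - \<alpha>)\<^sup>2)"
    by (simp add: power2_eq_square power3_eq_cube algebra_simps)
  then have third: "(\<alpha> - s - 1) ^ 3 / (s * t / \<alpha> * (s + 1 - \<alpha>))\<^sup>2
      = - ((s + 1 - \<alpha>) * \<alpha>\<^sup>2 / (s * t)\<^sup>2)"
    using assms by (simp add: power_mult_distrib power_divide)
  have "(s + 1 - \<alpha>) * \<alpha>\<^sup>2 < (s * t)\<^sup>2"
  proof (cases "\<alpha> \<le> t")
    case True
    have "(s + 1 - \<alpha>) * \<alpha>\<^sup>2 \<le> s * t\<^sup>2"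
      using assms True by (intro mult_mono power_mono) auto
    also have "\<dots> < s\<^sup>2 * t\<^sup>2"
      using assms by (simp add: power2_eq_square)
    finally show ?thesis by (simp add: power_mult_distrib)
  next
    case False
    \<comment> \<open>Here \<alpha> > t \<ge> 2 bounds the first factor, and \<alpha> \<le> t + 1
      \<le> 3t/2 bounds the second.\<close>
    have "(s + 1 - \<alpha>) * \<alpha>\<^sup>2 \<le> (s - 1) * (3 / 2 * t)\<^sup>2"
      using assms False by (intro mult_mono power_mono) auto
    also have "\<dots> = (9 / 4 * (s - 1)) * t\<^sup>2"
      by (simp add: power2_eq_square)
    also have "\<dots> < s\<^sup>2 * t\<^sup>2"
    proof (rule mult_strict_right_mono)
      \<comment> \<open>This completes the square in s^2 - 9s/4 + 9/4.\<close>
      have "0 < (s - 9 / 8)\<^sup>2 + 63 / 64" by (simp add: add_nonneg_pos)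
      then show "9 / 4 * (s - 1) < s\<^sup>2" by (simp add: power2_eq_square algebra_simps)
    qed (use assms in auto)
    finally show ?thesis by (simp add: power_mult_distrib)
  qed
  then have "(s + 1 - \<alpha>) * \<alpha>\<^sup>2 / (s * t)\<^sup>2 < 1"
    using assms by simp
  moreover have "(s - \<alpha>) ^ 3 / (s * (t + 1))\<^sup>2 \<ge> 0"
    using assms by simp
  ultimately show ?thesis unfolding third by linarith
qed

lemma krein_sum_2_eq_0_iff:
  fixes s t \<alpha> :: real
  assumes "s > 1" "t > 0" "\<alpha> > 0" "\<alpha> < s + 1"
  shows "1 + (- t - 1) ^ 3 / (s * (t + 1))\<^sup>2 + t ^ 3 / (s * t / \<alpha> * (s + 1 - \<alpha>))\<^sup>2 = 0
    \<longleftrightarrow> (t + 1 - s\<^sup>2) * (s + 1 - \<alpha>)\<^sup>2 = t * \<alpha>\<^sup>2"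
proof -
  have "(- t - 1) ^ 3 = - ((t + 1) * (t + 1)\<^sup>2)"
    by (simp add: power2_eq_square power3_eq_cube algebra_simps)
  then have second: "(- t - 1) ^ 3 / (s * (t + 1))\<^sup>2 = - ((t + 1) / s\<^sup>2)"
    using assms by (simp add: power_mult_distrib)
  define b where "b = s + 1 - \<alpha>"
  have "b > 0" using assms by (simp add: b_def)
  have combine: "1 + - ((t + 1) / s\<^sup>2) + u / s\<^sup>2 = 0 \<longleftrightarrow> t + 1 - s\<^sup>2 = u" for u
    using assms(1) by (auto simp: divide_simps)
  have third: "t ^ 3 / (s * t / \<alpha> * b)\<^sup>2 = t * \<alpha>\<^sup>2 / b\<^sup>2 / s\<^sup>2"
    using assms by (simp add: power_mult_distrib power_divide power2_eq_square power3_eq_cube)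
  show ?thesis
    unfolding b_def[symmetric] second third combine using \<open>b > 0\<close>
    by (simp add: field_simps)
qed

lemma krein_quadratic_root:
  fixes s t \<alpha> :: real
  assumes "s > 1" "t > 0" "\<alpha> > 0" "\<alpha> < s + 1" "s\<^sup>2 < t + 1"
  shows "(t + 1 - s\<^sup>2) * (s + 1 - \<alpha>)\<^sup>2 = t * \<alpha>\<^sup>2
    \<longleftrightarrow> \<alpha> = (s\<^sup>2 - t - 1 + sqrt (t * (t + 1 - s\<^sup>2))) / (s - 1)"
proof -
  define p r where "p = sqrt t" and "r = sqrt (t + 1 - s\<^sup>2)"
  have pr: "p > 0" "r > 0" "p\<^sup>2 = t" "r\<^sup>2 = t + 1 - s\<^sup>2"
    using assms by (auto simp: p_def r_def)
  have diff: "(p - r) * (p + r) = (s - 1) * (s + 1)"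
    using pr(3,4) by (simp add: algebra_simps power2_eq_square)
  have "(t + 1 - s\<^sup>2) * (s + 1 - \<alpha>)\<^sup>2 = t * \<alpha>\<^sup>2 \<longleftrightarrow> (r * (s + 1 - \<alpha>))\<^sup>2 = (p * \<alpha>)\<^sup>2"
    by (simp add: power_mult_distrib pr)
  \<comment> \<open>Both sides are nonnegative because 0 < \<alpha> < s + 1. This discards the other
    root and makes the equation linear in \<alpha>.\<close>
  also have "\<dots> \<longleftrightarrow> r * (s + 1 - \<alpha>) = p * \<alpha>"
    using pr assms by (intro power2_eq_iff_nonneg) auto
  also have "\<dots> \<longleftrightarrow> r * (s + 1) = (p + r) * \<alpha>"
    by (auto simp: algebra_simps)
  \<comment> \<open>The factor \<open>s - 1\<close> brings in (s - 1)(s + 1) = (p - r)(p + r), so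
    that \<open>p + r\<close> cancels and the root becomes r(p - r)/(s - 1).\<close>
  also have "\<dots> \<longleftrightarrow> (s - 1) * (r * (s + 1)) = (s - 1) * ((p + r) * \<alpha>)"
    using assms(1) by simp
  also have "\<dots> \<longleftrightarrow> (p + r) * (r * (p - r)) = (p + r) * (\<alpha> * (s - 1))"
    by (simp only: mult.left_commute[of _ r] mult.left_commute[of _ "p + r"]
        mult.commute[of "p + r" "p - r"] diff mult.commute[of \<alpha>])
  also have "\<dots> \<longleftrightarrow> \<alpha> * (s - 1) = r * (p - r)"
    using pr(1,2) by auto
  also have "\<dots> \<longleftrightarrow> \<alpha> * (s - 1) = p * r - r\<^sup>2"
    by (simp add: right_diff_distrib power2_eq_square mult.commute[of r p])
  also have "\<dots> \<longleftrightarrow> \<alpha> = (s\<^sup>2 - t - 1 + sqrt (t * (t + 1 - s\<^sup>2))) / (s - 1)"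
    using assms by (simp add: pr(4) eq_divide_eq p_def r_def real_sqrt_mult) argo
  finally show ?thesis .
qed

text \<open>The right side is positive and the square is nonnegative, so the first factor is
  positive. For integers this is the condition \<open>t \<ge> s\<^sup>2\<close>.\<close>

lemma krein_quadratic_bound:
  fixes s t \<alpha> :: real
  assumes "(t + 1 - s\<^sup>2) * (s + 1 - \<alpha>)\<^sup>2 = t * \<alpha>\<^sup>2" "t > 0" "\<alpha> > 0"
  shows "s\<^sup>2 < t + 1"
proof -
  have "(t + 1 - s\<^sup>2) * (s + 1 - \<alpha>)\<^sup>2 > 0" using assms by simp
  then show ?thesis by (simp add: zero_less_mult_iff)
qed

lemma krein_quadratic_alpha_1_iff:
  fixes s t \<alpha> :: real
  assumes eq: "(t + 1 - s\<^sup>2) * (s + 1 - \<alpha>)\<^sup>2 = t * \<alpha>\<^sup>2"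
    and "s > 1" "\<alpha> > 0" "\<alpha> < s + 1"
  shows "\<alpha> = 1 \<longleftrightarrow> t = s\<^sup>2"
proof
  assume "\<alpha> = 1"
  with eq have "(s\<^sup>2 - 1) * (t - s\<^sup>2) = 0"
    by (simp add: algebra_simps power2_eq_square)
  moreover have "s\<^sup>2 \<noteq> 1" using \<open>s > 1\<close> by (simp add: power2_eq_1_iff)
  ultimately show "t = s\<^sup>2" by simp
next
  assume "t = s\<^sup>2"
  \<comment> \<open>For \<open>t = s\<^sup>2\<close> the first factor is 1, and taking nonnegative
    roots leaves a linear equation.\<close>
  with eq have "(s + 1 - \<alpha>)\<^sup>2 = (s * \<alpha>)\<^sup>2" by (simp add: power_mult_distrib)
  then have "s + 1 - \<alpha> = s * \<alpha>" using assms by (subst (asm) power2_eq_iff_nonneg) auto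
  then have "(s + 1) * (\<alpha> - 1) = 0" unfolding ring_distribs by linarith
  then show "\<alpha> = 1" using \<open>s > 1\<close> by simp
qed

section \<open>The collinearity scheme of a thick partial geometry\<close>

theorem theorem5p1:
  fixes inc :: "'p::finite \<Rightarrow> 'l \<Rightarrow> bool"
    and s t \<alpha> :: nat
    and E :: "nat \<Rightarrow> real ^ 'p ^ 'p"
  assumes "thick_partial_geometry inc s t \<alpha>"
    and "bij_betw E {..2} {F. minimal_idempotent (bose_mesner_algebra 2 (adjacency_matrix inc)) F}"
    and "E 0 = (\<chi> x y. 1 / real CARD('p))"
    and "matrix_of_eigenvalues 2 (adjacency_matrix inc) E (pg_eigenvalues s t \<alpha>)"
  shows "\<forall>i\<in>{1, 2}.
      (krein_parameter 2 E i i i = 0 \<longleftrightarrow>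
         i = 2 \<and>
         real \<alpha> = ((real s)\<^sup>2 - real t - 1 + sqrt (real t * (real t + 1 - (real s)\<^sup>2)))
                      / (real s - 1) \<and>
         t \<ge> s\<^sup>2) \<and>
      (krein_parameter 2 E i i i = 0 \<longrightarrow> (\<alpha> = 1 \<longleftrightarrow> t = s\<^sup>2))"
proof -
  let ?A = "adjacency_matrix inc" and ?P = "pg_eigenvalues s t \<alpha>"
  have st: "s > 1" "t > 1" and pg: "partial_geometry inc s t \<alpha>"
    using assms(1) by (auto simp: thick_partial_geometry_def)
  have minimal: "minimal_idempotent (bose_mesner_algebra 2 ?A) (E i)" if "i \<le> 2" for i
    using assms(2) that by (auto simp: bij_betw_def)
  \<comment> \<open>A nonpositive valency would force \<open>?A 2 = 0\<close>, as the entries are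
    nonnegative; but \<open>?A 2\<close> acts on the nonzero \<open>E 2\<close> as t > 0. This
    excludes a complete collinearity graph.\<close>
  have P02: "?P 0 2 > 0"
  proof (rule ccontr)
    assume "\<not> ?P 0 2 > 0"
    then have le: "(\<Sum>y\<in>UNIV. ?A 2 $ x $ y) \<le> 0" for x
      using row_sum_eq_eigenvalue[OF assms(4) _ assms(3), of 2 x] by simp
    have nonneg: "?A 2 $ x $ y \<ge> 0" for x y
      by (simp add: adjacency_matrix_def)
    have "(\<Sum>y\<in>UNIV. ?A 2 $ x $ y) = 0" for x
      using le[of x] nonneg by (meson antisym sum_nonneg)
    then have "?A 2 $ x $ y = 0" for x y
      using nonneg by (simp add: sum_nonneg_eq_0_iff)
    then have "?A 2 = 0" by (simp add: vec_eq_iff)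
    then have "real t *\<^sub>R E 2 = 0"
      using matrix_of_eigenvalues_mult[OF assms(4), of 2 2] by simp
    then show False using minimal[of 2] st by (simp add: minimal_idempotent_def)
  qed
  have \<alpha>: "\<alpha> > 0" "\<alpha> \<le> s"
  proof -
    \<comment> \<open>Division by zero yields 0, so \<alpha> = 0 would make \<open>?P 0 2\<close>
      vanish.\<close>
    show "\<alpha> > 0" using P02 by (cases "\<alpha> = 0") auto
    then have "real s * real t / real \<alpha> > 0" using st by simp
    then have "real s + 1 - real \<alpha> > 0" using P02
      by (simp only: pg_eigenvalues_simps zero_less_mult_iff) linarith
    then show "\<alpha> \<le> s" by linarith
  qed
  have le2: "k = 0 \<or> k = 1 \<or> k = 2" if "k \<le> 2" for k :: nat
    using that by auto
  define c where "c x y = (if x = y then 0 else if collinear_points inc x y then 1 else 2 :: nat)"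
    for x y
  interpret symmetric_scheme c 2 ?A E ?P
  proof
    show "?A k = (\<chi> x y. of_bool (c x y = k))" for k
      by (auto simp: adjacency_matrix_def c_def vec_eq_iff)
    show "c x y = c y x" for x y
      by (auto simp: c_def collinear_points_def)
    show "c x y \<le> 2" "c x y = 0 \<longleftrightarrow> x = y" for x y
      by (auto simp: c_def)
    show "E i \<in> bose_mesner_algebra 2 ?A" "E i ** E i = E i" "E i \<noteq> 0" if "i \<le> 2" for i
      using minimal[OF that] by (auto simp: minimal_idempotent_def)
    show "?P 0 k \<noteq> 0" if "k \<le> 2" for k
      using le2[OF that] P02 st by auto
    \<comment> \<open>Collinearity alone separates the idempotents: s(t + 1) > s - \<alpha> \<ge> 0
      > -t - 1.\<close>
    have "?P 0 1 \<noteq> ?P 1 1" "?P 0 1 \<noteq> ?P 2 1" "?P 1 1 \<noteq> ?P 2 1"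
    proof -
      have "real s * real t > 0" using st by simp
      then have "real s * (real t + 1) > 0" "real s * (real t + 1) > real s - real \<alpha>"
        unfolding ring_distribs using st by linarith+
      then show "?P 0 1 \<noteq> ?P 1 1" "?P 0 1 \<noteq> ?P 2 1" "?P 1 1 \<noteq> ?P 2 1"
        using \<alpha> unfolding pg_eigenvalues_simps by linarith+
    qed
    then show "\<exists>k\<le>2. ?P i k \<noteq> ?P j k" if "i \<le> 2" "j \<le> 2" "i \<noteq> j" for i j
      using le2[OF that(1)] le2[OF that(2)] that(3) by (intro exI[of _ 1]) auto
  qed (use assms in auto)
  have krein: "krein_parameter 2 E i i i = 0 \<longleftrightarrow>
      ?P i 0 ^ 3 / (?P 0 0)\<^sup>2 + ?P i 1 ^ 3 / (?P 0 1)\<^sup>2 + ?P i 2 ^ 3 / (?P 0 2)\<^sup>2 = 0"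
    if "i \<le> 2" for i
    using krein_parameter_eq_0_iff[OF that] by (simp add: numeral_2_eq_2)
  let ?Q = "(real t + 1 - (real s)\<^sup>2) * (real s + 1 - real \<alpha>)\<^sup>2 = real t * (real \<alpha>)\<^sup>2"
  have krein_1: "krein_parameter 2 E 1 1 1 \<noteq> 0"
    using krein_sum_1_pos[of "real s" "real t" "real \<alpha>"] st \<alpha>
      partial_geometry_alpha_le[OF pg] krein[of 1] by simp
  have krein_2: "krein_parameter 2 E 2 2 2 = 0 \<longleftrightarrow> ?Q"
    using krein_sum_2_eq_0_iff[of "real s" "real t" "real \<alpha>"] st \<alpha> krein[of 2] by simp
  \<comment> \<open>Integrality turns the strict bound by \<open>t + 1\<close> into a weak bound by
    \<open>t\<close>.\<close>
  have bound: "(real s)\<^sup>2 < real t + 1 \<longleftrightarrow> t \<ge> s\<^sup>2"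
    by (metis of_nat_Suc of_nat_less_iff of_nat_power add.commute less_Suc_eq_le)
  have "?Q \<longleftrightarrow> real \<alpha> = ((real s)\<^sup>2 - real t - 1 + sqrt (real t * (real t + 1 - (real s)\<^sup>2)))
      / (real s - 1) \<and> t \<ge> s\<^sup>2"
    using krein_quadratic_root[of "real s" "real t" "real \<alpha>"]
      krein_quadratic_bound[of "real t" "real s" "real \<alpha>"] st \<alpha> bound by auto
  moreover have "\<alpha> = 1 \<longleftrightarrow> t = s\<^sup>2" if ?Q
  proof -
    have "real \<alpha> = 1 \<longleftrightarrow> real t = (real s)\<^sup>2"
      using krein_quadratic_alpha_1_iff[OF that] st \<alpha> by simp
    then show ?thesis by (metis of_nat_1_eq_iff of_nat_eq_iff of_nat_power)
  qed
  ultimately show ?thesis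
    using krein_1 krein_2 by auto
qed

end
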